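(* Let $\mathcal{M}=(X,rk,m)$ be a multiplicity matroid whose underlying matroid $M=(X,rk)$ is loopless, and write $\mathfrak{M}_{\mathcal{M}}(x,y)=\sum_{i,j\ge0}b_{i,j}x^iy^j$. Then (1) $b_{rk(M),0}=m(\emptyset)$; (2) $b_{rk(M)-1,0}=(p(M)-rk(M))m(\emptyset)+\sum_{F\in\mathcal{F}_1(M)}\sum_{A\subseteq F}(-1)^{|A|+1}m(A)$; (3) \[b_{rk(M)-2,0}=\Big(\tbinom{rk(M)}{2}-(rk(M)-1)p(M)+\sum_{F\in\mathcal{F}_2(M)}(p(F)-1)\Big)m(\emptyset)+\sum_{F\in\mathcal{F}_1(M)}(p(M/F)-rk(M)+1)\sum_{A\subseteq F}(-1)^{|A|+1}m(A)+\sum_{F\in\mathcal{F}_2(M)}\sum_{A\subseteq F}(-1)^{|A|}m(A);\] (4) $b_{rk(M)-1,1}=\sum_{F\in\mathcal{F}'_1(M)}\sum_{A\subseteq F,|A|\ge2}(-1)^{|A|}(|A|-1)m(A)$; (5) \[b_{rk(M)-2,1}=\sum_{F\in\mathcal{F}'_1(M)}(p(M/F)-rk(M)+1)\sum_{A\subseteq F,|A|\ge2}(-1)^{|A|}(|A|-1)m(A)+\sum_{F\in\mathcal{F}_2(M)}\sum_{A\subseteq F,|A|\ge2}(-1)^{|A|+1}(|A|-rk(A))m(A);\] (6) \[b_{rk(M)-2,2}=\sum_{F\in\mathcal{F}'_1(M)}(p(M/F)-rk(M)+1)\sum_{A\subseteq F,|A|\ge3}(-1)^{|A|+1}\tbinom{|A|-1}{2}m(A)+\sum_{F\in\mathcal{F}_2(M)}\sum_{A\subseteq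 F,|A|\ge3}(-1)^{|A|}\tbinom{|A|-rk(A)}{2}m(A).\]
   Context: A matroid $(X,rk)$ is a finite set with rank function $rk:2^X\to\mathbb{Z}_{\ge0}$ satisfying $rk(A)\le|A|$, monotonicity and submodularity; $rk(M)=rk(X)$; loopless means no $e$ with $rk(\{e\})=0$. A multiplicity matroid $\mathcal{M}=(X,rk,m)$ is a matroid with an arbitrary function $m:2^X\to\mathbb{Z}_{>0}$; its multiplicity Tutte polynomial is $\mathfrak{M}_{\mathcal{M}}(x,y)=\sum_{A\subseteq X}m(A)(x-1)^{rk(X)-rk(A)}(y-1)^{|A|-rk(A)}$. A flat is a set $F$ with $\{e:rk(F\cup\{e\})=rk(F)\}=F$; a circuit is a set $C$ with $rk(C\setminus\{e\})=|C|-1=rk(C)$ for all $e\in C$; a flat $F$ is cyclic if every $e\in F$ lies in a circuit contained in $F$. $\mathcal{F}_i(M)$ is the set of flats of rank $i$ and $\mathcal{F}'_i(M)$ the set of cyclic flats of rank $i$. Elements $e,f$ are parallel if $rk(\{e,f\})=rk(\{e\})=rk(\{f\})=1$; a parallel class is a maximal set of non-loop elements pairwise parallel. $p(N)$ is the number of parallel classes of a matroid $N$; $p(F)$ means $p(M|F)$ for the restriction $M|F$ (rank function restricted to subsets of $F$). The contraction $M/F$ is the matroid on $X\setminus F$ with $rk_{M/F}(A)=rk(A\cup F)-rk(F)$. *)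

theory Defs
  imports "HOL-Computational_Algebra.Polynomial"
begin

section \<open>Matroids given by a rank function\<close>

text \<open>Only the values of \<open>rk\<close> on subsets of \<open>ground\<close> are meaningful.\<close>

record 'a ranked_set =
  ground :: "'a set"
  rk :: "'a set \<Rightarrow> nat"

definition matroid :: "'a ranked_set \<Rightarrow> bool" where
  "matroid M \<longleftrightarrow>
     finite (ground M) \<and>
     (\<forall>A. A \<subseteq> ground M \<longrightarrow> rk M A \<le> card A) \<and>
     (\<forall>A B. A \<subseteq> B \<longrightarrow> B \<subseteq> ground M \<longrightarrow> rk M A \<le> rk M B) \<and>
     (\<forall>A B. A \<subseteq> ground M \<longrightarrow> B \<subseteq> ground M \<longrightarrow>
        rk M (A \<union> B) + rk M (A \<inter> B) \<le> rk M A + rk M B)"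

definition total_rank :: "'a ranked_set \<Rightarrow> nat" where
  "total_rank M = rk M (ground M)"

definition loopless :: "'a ranked_set \<Rightarrow> bool" where
  "loopless M \<longleftrightarrow> \<not> (\<exists>e \<in> ground M. rk M {e} = 0)"

definition flat :: "'a ranked_set \<Rightarrow> 'a set \<Rightarrow> bool" where
  "flat M F \<longleftrightarrow> F \<subseteq> ground M \<and> {e \<in> ground M. rk M (F \<union> {e}) = rk M F} = F"

text \<open>
  The empty set satisfies the quantified condition vacuously, and is not a circuit.
\<close>

definition circuit :: "'a ranked_set \<Rightarrow> 'a set \<Rightarrow> bool" where
  "circuit M C \<longleftrightarrow> C \<subseteq> ground M \<and> C \<noteq> {} \<and>
     (\<forall>e \<in> C. rk M (C - {e}) = card C - 1 \<and> rk M C = card C - 1)"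

definition cyclic_flat :: "'a ranked_set \<Rightarrow> 'a set \<Rightarrow> bool" where
  "cyclic_flat M F \<longleftrightarrow> flat M F \<and> (\<forall>e \<in> F. \<exists>C. circuit M C \<and> C \<subseteq> F \<and> e \<in> C)"

definition flats_of_rank :: "'a ranked_set \<Rightarrow> nat \<Rightarrow> 'a set set" where
  "flats_of_rank M i = {F. flat M F \<and> rk M F = i}"

definition cyclic_flats_of_rank :: "'a ranked_set \<Rightarrow> nat \<Rightarrow> 'a set set" where
  "cyclic_flats_of_rank M i = {F. cyclic_flat M F \<and> rk M F = i}"

definition parallel :: "'a ranked_set \<Rightarrow> 'a \<Rightarrow> 'a \<Rightarrow> bool" where
  "parallel M e f \<longleftrightarrow> rk M {e, f} = 1 \<and> rk M {e} = 1 \<and> rk M {f} = 1"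

definition parallel_set :: "'a ranked_set \<Rightarrow> 'a set \<Rightarrow> bool" where
  "parallel_set M P \<longleftrightarrow> P \<subseteq> {e \<in> ground M. rk M {e} \<noteq> 0} \<and> (\<forall>e \<in> P. \<forall>f \<in> P. parallel M e f)"

text \<open>
  Classes are nonempty, so that a matroid without non-loop elements has no parallel class
  (and not the empty set as its only one).
\<close>

definition parallel_class :: "'a ranked_set \<Rightarrow> 'a set \<Rightarrow> bool" where
  "parallel_class M P \<longleftrightarrow> P \<noteq> {} \<and> parallel_set M P \<and>
     (\<forall>Q. parallel_set M Q \<longrightarrow> P \<subseteq> Q \<longrightarrow> Q = P)"

definition num_parallel_classes :: "'a ranked_set \<Rightarrow> nat" where
  "num_parallel_classes M = card {P. parallel_class M P}"

definition restriction :: "'a ranked_set \<Rightarrow> 'a set \<Rightarrow> 'a ranked_set" where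
  "restriction M F = \<lparr>ground = F, rk = rk M\<rparr>"

definition contraction :: "'a ranked_set \<Rightarrow> 'a set \<Rightarrow> 'a ranked_set" where
  "contraction M F = \<lparr>ground = ground M - F, rk = (\<lambda>A. rk M (A \<union> F) - rk M F)\<rparr>"


section \<open>Multiplicity matroids and their Tutte polynomial\<close>

definition multiplicity_matroid :: "'a ranked_set \<Rightarrow> ('a set \<Rightarrow> int) \<Rightarrow> bool" where
  "multiplicity_matroid M m \<longleftrightarrow> matroid M \<and> (\<forall>A. A \<subseteq> ground M \<longrightarrow> m A > 0)"

text \<open>
  Polynomials in \<open>x\<close> and \<open>y\<close> are polynomials in \<open>x\<close> whose coefficients are
  polynomials in \<open>y\<close>.
\<close>

definition var_x :: "int poly poly" where
  "var_x = [:0, 1:]"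

definition var_y :: "int poly poly" where
  "var_y = [:[:0, 1:]:]"

definition multiplicity_tutte :: "'a ranked_set \<Rightarrow> ('a set \<Rightarrow> int) \<Rightarrow> int poly poly" where
  "multiplicity_tutte M m =
     (\<Sum>A \<in> Pow (ground M).
        of_int (m A) * (var_x - 1) ^ (total_rank M - rk M A) * (var_y - 1) ^ (card A - rk M A))"

text \<open>
  The coefficient of \<open>x\<^sup>i y\<^sup>j\<close>. Indices are integers and the coefficient is 0 if one of them
  is negative, so that expressions such as \<open>b\<^bsub>r-2,0\<^esub>\<close> make sense for every rank \<open>r\<close>.
\<close>

definition tutte_coeff :: "'a ranked_set \<Rightarrow> ('a set \<Rightarrow> int) \<Rightarrow> int \<Rightarrow> int \<Rightarrow> int" where
  "tutte_coeff M m i j =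
     (if i < 0 \<or> j < 0 then 0 else coeff (coeff (multiplicity_tutte M m) (nat i)) (nat j))"

lemma multiplicity_tutte_eval:
  "poly (poly (multiplicity_tutte M m) [:x:]) y =
     (\<Sum>A \<in> Pow (ground M).
        m A * (x - 1) ^ (total_rank M - rk M A) * (y - 1) ^ (card A - rk M A))"
  by (simp add: multiplicity_tutte_def var_x_def var_y_def poly_sum)

end

theory Submission imports Defs begin

text \<open>
  By the binomial theorem, the coefficient of \<open>x\<^bsup>r-k\<^esup> y\<^sup>j\<close> only sees the
  sets \<open>A\<close> of rank at most \<open>k\<close>. Each \<open>A\<close> lies in a unique flat of rank \<open>rk A\<close>, so the sum over the
  sets of rank \<open>k\<close> is the sum over the flats of rank \<open>k\<close> and all their subsets, corrected by the
  subsets of smaller rank. A nonempty subset of a rank 1 flat \<open>F\<close> lies in \<open>p(M/F)\<close> flats of rank 2,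
  because in a loopless matroid the parallel classes are exactly the flats of rank 1. Counting
  pairs of nested flats of ranks 1 and 2 turns the resulting \<open>\<Sum>\<^sub>F p(M/F)\<close> into \<open>\<Sum>\<^sub>F p(F)\<close>.
\<close>

section \<open>Double counting, and coefficients of powers of \<open>x - 1\<close> and
  \<open>y - 1\<close>\<close>

lemma sum_restrict_count:
  fixes g :: "'b \<Rightarrow> int"
  assumes "finite I" "finite J"
  shows "(\<Sum>x\<in>I. \<Sum>y\<in>{y\<in>J. R x y}. g y) = (\<Sum>y\<in>J. int (card {x\<in>I. R x y}) * g y)"
  using assms by (subst sum.swap_restrict) auto

text \<open>For \<open>i > n\<close> both sides vanish, the left one by degree and the right one by
  the binomial coefficient, so the truncated exponent \<open>n - i\<close> does no harm.\<close>

lemma coeff_minus_one_power: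
  "coeff ([:- 1, 1:] ^ n :: 'b::comm_ring_1 poly) i = of_nat (n choose i) * (- 1) ^ (n - i)"
proof (cases "i \<le> n")
  case True
  then show ?thesis by (subst coeff_linear_poly_power) auto
next
  case False
  then show ?thesis
    by (simp add: coeff_eq_0 degree_linear_power binomial_eq_0)
qed

lemma coeff_tutte_term:
  "coeff (coeff (of_int c * (var_x - 1) ^ a * (var_y - 1) ^ b) i) j
    = c * (int (a choose i) * (- 1) ^ (a - i)) * (int (b choose j) * (- 1) ^ (b - j))"
proof -
  have x: "var_x - 1 = [:- 1, 1:]"
    by (simp add: var_x_def one_pCons)
  \<comment> \<open>The power of \<open>y - 1\<close> is constant in \<open>x\<close>, so the
    coefficient of the product splits into a factor for \<open>x\<close> and a factor for
    \<open>y\<close>.\<close>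
  have y: "(var_y - 1) ^ b = [:[:- 1, 1:] ^ b:]"
    by (simp add: var_y_def one_pCons poly_const_pow)
  have sgn: "(- 1) ^ n = ([:(- 1) ^ n:] :: int poly)" for n
    by (simp add: one_pCons flip: poly_const_pow)
  show ?thesis
    unfolding x y
    by (simp add: of_int_poly of_nat_poly coeff_minus_one_power sgn)
qed


text \<open>The multiplicity is kept out of the locale, which is interpreted below for restrictions
  and contractions to flats as well; the description of parallel classes then transfers to both
  minors.\<close>

locale loopless_matroid =
  fixes M :: "'a ranked_set"
  assumes matroid: "matroid M" and loopless: "loopless M"
begin

abbreviation "E \<equiv> ground M"
abbreviation "r \<equiv> rk M"

section \<open>Rank function of a loopless matroid\<close>

lemma finite_ground: "finite E"
  using matroid by (simp add: matroid_def)

lemma finite_subset_ground: "A \<subseteq> E \<Longrightarrow> finite A"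
  using finite_ground finite_subset by blast

lemma rk_le_card: "A \<subseteq> E \<Longrightarrow> r A \<le> card A"
  using matroid by (simp add: matroid_def)

lemma rk_mono: "A \<subseteq> B \<Longrightarrow> B \<subseteq> E \<Longrightarrow> r A \<le> r B"
  using matroid unfolding matroid_def by blast

lemma rk_submodular: "A \<subseteq> E \<Longrightarrow> B \<subseteq> E \<Longrightarrow> r (A \<union> B) + r (A \<inter> B) \<le> r A + r B"
  using matroid unfolding matroid_def by blast

lemma rk_empty [simp]: "r {} = 0"
  using rk_le_card[of "{}"] by simp

lemma rk_singleton: "e \<in> E \<Longrightarrow> r {e} = 1"
  using rk_le_card[of "{e}"] loopless by (force simp: loopless_def)

lemma rk_eq_0_iff: "A \<subseteq> E \<Longrightarrow> r A = 0 \<longleftrightarrow> A = {}"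
proof
  assume "A \<subseteq> E" "r A = 0"
  show "A = {}"
  proof (rule ccontr)
    assume "A \<noteq> {}"
    then obtain e where "e \<in> A" by blast
    then show False
      using rk_mono[of "{e}" A] rk_singleton[of e] \<open>A \<subseteq> E\<close> \<open>r A = 0\<close> by auto
  qed
qed simp

text \<open>Submodularity is applied to \<open>B\<close> and \<open>insert e A\<close>: their union
  is \<open>insert e B\<close>, and their intersection contains \<open>A\<close>. Thus an element
  spanned by \<open>A\<close> is spanned by every larger set.\<close>

lemma rk_insert_mono:
  assumes "A \<subseteq> B" "B \<subseteq> E" "e \<in> E" "r (insert e A) = r A"
  shows "r (insert e B) = r B"
proof -
  have "r (B \<union> insert e A) + r (B \<inter> insert e A) \<le> r B + r (insert e A)"
    using assms by (intro rk_submodular) auto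
  moreover have "r A \<le> r (B \<inter> insert e A)"
    using assms by (intro rk_mono) auto
  moreover have "B \<union> insert e A = insert e B"
    using assms by auto
  moreover have "r B \<le> r (insert e B)"
    using assms by (intro rk_mono) auto
  ultimately show ?thesis using assms(4) by simp
qed

text \<open>The elements of \<open>B\<close> are added one at a time; each is spanned by
  \<open>A\<close>, hence also by what has been built so far.\<close>

lemma rk_Un_eq:
  assumes "A \<subseteq> E" "B \<subseteq> E" "\<And>e. e \<in> B \<Longrightarrow> r (insert e A) = r A"
  shows "r (A \<union> B) = r A"
proof -
  have "finite B" using assms finite_subset_ground by blast
  then show ?thesis using assms
  proof (induction B rule: finite_induct)
    case (insert e B)
    then have "r (insert e (A \<union> B)) = r (A \<union> B)"
      by (simp add: rk_insert_mono[of A "A \<union> B" e])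
    with insert show ?case by simp
  qed simp
qed

section \<open>Flats and closures\<close>

lemma flat_iff:
  "flat M F \<longleftrightarrow> F \<subseteq> E \<and> (\<forall>e \<in> E - F. r F < r (insert e F))"
proof -
  have "r F \<le> r (insert e F)" if "F \<subseteq> E" "e \<in> E" for e
    using that by (intro rk_mono) auto
  then have "r F < r (insert e F) \<longleftrightarrow> r (insert e F) \<noteq> r F" if "F \<subseteq> E" "e \<in> E" for e
    using that by fastforce
  then show ?thesis
    unfolding flat_def by (auto simp: insert_absorb)
qed

lemma flat_memI: "flat M F \<Longrightarrow> e \<in> E \<Longrightarrow> r (insert e F) = r F \<Longrightarrow> e \<in> F"
  by (metis DiffI flat_iff less_irrefl)

lemma finite_flats_of_rank: "finite (flats_of_rank M i)"
  by (rule finite_subset[of _ "Pow E"])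
    (auto simp: flats_of_rank_def flat_def finite_ground)

lemma flats_of_rank_subset: "F \<in> flats_of_rank M i \<Longrightarrow> F \<subseteq> E"
  by (simp add: flats_of_rank_def flat_def)

lemma rk_flats_of_rank: "F \<in> flats_of_rank M i \<Longrightarrow> r F = i"
  by (simp add: flats_of_rank_def)

text \<open>The witness is the closure of \<open>A\<close>. A flat of the same rank above
  \<open>A\<close> has to agree with it: its elements cannot raise the rank of \<open>A\<close>, and
  it contains everything that \<open>A\<close> spans.\<close>

lemma ex1_flat:
  assumes "A \<subseteq> E"
  shows "\<exists>!F. F \<in> flats_of_rank M (r A) \<and> A \<subseteq> F"
proof
  let ?F = "{e \<in> E. r (insert e A) = r A}"
  have sub: "A \<subseteq> ?F" using assms by (auto simp: insert_absorb)
  have "r (A \<union> ?F) = r A" using assms by (intro rk_Un_eq) auto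
  moreover have "A \<union> ?F = ?F" using sub by auto
  ultimately have rk: "r ?F = r A" by simp
  have "r ?F < r (insert e ?F)" if "e \<in> E - ?F" for e
  proof -
    have "r A \<le> r (insert e A)" "r (insert e A) \<le> r (insert e ?F)"
      using assms that sub by (intro rk_mono; auto)+
    then show ?thesis using that rk by auto
  qed
  then have "flat M ?F" by (auto simp: flat_iff)
  with rk sub show "?F \<in> flats_of_rank M (r A) \<and> A \<subseteq> ?F"
    by (simp add: flats_of_rank_def)
  fix F assume F: "F \<in> flats_of_rank M (r A) \<and> A \<subseteq> F"
  then have flat: "flat M F" and rF: "r F = r A" and "A \<subseteq> F" and "F \<subseteq> E"
    by (auto simp: flats_of_rank_def flat_def)
  show "F = ?F"
  proof (intro equalityI subsetI)
    fix e assume "e \<in> F"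
    then have "r A \<le> r (insert e A)" "r (insert e A) \<le> r F"
      using \<open>A \<subseteq> F\<close> \<open>F \<subseteq> E\<close> by (intro rk_mono; auto)+
    then show "e \<in> ?F" using rF \<open>F \<subseteq> E\<close> \<open>e \<in> F\<close> by auto
  next
    fix e assume "e \<in> ?F"
    then have "r (insert e F) = r F"
      using rk_insert_mono[of A F e] \<open>A \<subseteq> F\<close> \<open>F \<subseteq> E\<close> by auto
    then show "e \<in> F" using flat \<open>e \<in> ?F\<close> flat_memI by blast
  qed
qed

lemma card_flats_above:
  assumes "A \<subseteq> E" "r A = i"
  shows "card {F \<in> flats_of_rank M i. A \<subseteq> F} = 1"
proof -
  obtain F where "{F \<in> flats_of_rank M i. A \<subseteq> F} = {F}"
    using ex1_flat[OF assms(1)] assms(2) by blast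
  then show ?thesis by simp
qed

text \<open>Here \<open>F\<close> is the closure of \<open>A\<close>, and a flat containing
  \<open>A\<close> contains all that \<open>A\<close> spans. Hence the number of flats above
  \<open>A\<close> depends only on the closure of \<open>A\<close>.\<close>

lemma flats_above_eq_flats_above_closure:
  assumes "A \<subseteq> F" "F \<in> flats_of_rank M (r A)"
  shows "{G \<in> flats_of_rank M i. A \<subseteq> G} = {G \<in> flats_of_rank M i. F \<subseteq> G}"
proof -
  have "F \<subseteq> G" if G: "G \<in> flats_of_rank M i" and "A \<subseteq> G" for G
  proof
    fix e assume "e \<in> F"
    have E: "F \<subseteq> E" "G \<subseteq> E" using assms G flats_of_rank_subset by auto
    have "r A \<le> r (insert e A)" "r (insert e A) \<le> r F"
      using assms E \<open>e \<in> F\<close> by (intro rk_mono; auto)+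
    then have "r (insert e A) = r A"
      using assms rk_flats_of_rank by fastforce
    then have "r (insert e G) = r G"
      using rk_insert_mono[of A G e] E \<open>A \<subseteq> G\<close> \<open>e \<in> F\<close> by auto
    then show "e \<in> G"
      using G E \<open>e \<in> F\<close> by (fastforce simp: flats_of_rank_def flat_iff)
  qed
  then show ?thesis using assms(1) by blast
qed

section \<open>Parallel classes as flats of rank 1\<close>

lemma rk_pair:
  assumes "P \<subseteq> E" "r P = 1" "e \<in> P" "f \<in> P"
  shows "r {e, f} = 1"
proof (rule antisym)
  show "r {e, f} \<le> 1" using rk_mono[of "{e, f}" P] assms by simp
  have "r {e} \<le> r {e, f}" using assms by (intro rk_mono) auto
  then show "1 \<le> r {e, f}" using rk_singleton[of e] assms by auto
qed

text \<open>For a fixed \<open>e\<close> in \<open>P\<close>, parallelism says that no element of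
  \<open>P\<close> raises the rank of \<open>{e}\<close>, so all of \<open>P\<close> has rank 1. The
  empty set is excluded because it is a parallel set of rank 0.\<close>

lemma parallel_set_iff:
  assumes "P \<noteq> {}"
  shows "parallel_set M P \<longleftrightarrow> P \<subseteq> E \<and> r P = 1"
proof
  assume P: "parallel_set M P"
  obtain e where e: "e \<in> P" using assms by blast
  have sub: "P \<subseteq> E" using P by (auto simp: parallel_set_def)
  have "r ({e} \<union> P) = r {e}"
    using P sub e by (intro rk_Un_eq) (auto simp: parallel_set_def parallel_def insert_commute)
  then show "P \<subseteq> E \<and> r P = 1"
    using e sub rk_singleton by (auto simp: insert_absorb)
next
  assume P: "P \<subseteq> E \<and> r P = 1"
  with rk_pair[of P] show "parallel_set M P"
    by (auto simp: parallel_set_def parallel_def rk_singleton subset_iff)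
qed

text \<open>The closure of a nonempty parallel set is again parallel, so maximality forces a flat.
  Conversely, any element outside a flat of rank 1 would raise the rank above 1.\<close>

lemma parallel_class_iff: "parallel_class M P \<longleftrightarrow> P \<in> flats_of_rank M 1"
proof
  assume P: "parallel_class M P"
  then have "P \<noteq> {}" "P \<subseteq> E" "r P = 1"
    using parallel_set_iff by (auto simp: parallel_class_def)
  then obtain F where F: "F \<in> flats_of_rank M 1" "P \<subseteq> F"
    using ex1_flat[of P] by auto
  then have "parallel_set M F"
    using \<open>P \<noteq> {}\<close> parallel_set_iff[of F] by (auto simp: flats_of_rank_def flat_def)
  then show "P \<in> flats_of_rank M 1"
    using P F by (auto simp: parallel_class_def)
next
  assume P: "P \<in> flats_of_rank M 1"
  then have rP: "P \<subseteq> E" "r P = 1" by (auto simp: flats_of_rank_def flat_def)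
  then have "P \<noteq> {}" by auto
  have "Q = P" if Q: "parallel_set M Q" "P \<subseteq> Q" for Q
  proof -
    have rQ: "Q \<subseteq> E" "r Q = 1"
      using Q \<open>P \<noteq> {}\<close> parallel_set_iff[of Q] by auto
    have "e \<in> P" if "e \<in> Q" for e
    proof (rule ccontr)
      assume "e \<notin> P"
      then have "r P < r (insert e P)"
        using P that rQ by (auto simp: flats_of_rank_def flat_iff)
      also have "\<dots> \<le> r Q" using that Q rQ by (intro rk_mono) auto
      finally show False using rP rQ by simp
    qed
    then show ?thesis using Q by auto
  qed
  then show "parallel_class M P"
    using \<open>P \<noteq> {}\<close> rP parallel_set_iff by (auto simp: parallel_class_def)
qed

lemma num_parallel_classes_eq: "num_parallel_classes M = card (flats_of_rank M 1)"
  by (simp add: num_parallel_classes_def parallel_class_iff)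

section \<open>Parallel classes of restrictions and contractions\<close>

lemma num_parallel_classes_restriction:
  assumes "flat M F"
  shows "num_parallel_classes (restriction M F) = card {G \<in> flats_of_rank M 1. G \<subseteq> F}"
proof -
  have F: "F \<subseteq> E" using assms by (simp add: flat_def)
  interpret R: loopless_matroid "restriction M F"
  proof
    show "matroid (restriction M F)"
      unfolding matroid_def restriction_def using F
      by (auto intro!: rk_le_card rk_mono rk_submodular finite_subset_ground)
    show "loopless (restriction M F)"
      using F rk_singleton by (auto simp: loopless_def restriction_def)
  qed
  \<comment> \<open>This uses that \<open>F\<close> is a flat: an element outside \<open>F\<close>
    that is spanned by \<open>G\<close> would also be spanned by \<open>F\<close>.\<close>
  have "flat (restriction M F) G \<longleftrightarrow> flat M G \<and> G \<subseteq> F" for G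
  proof -
    have "r G < r (insert e G)" if "G \<subseteq> F" "e \<in> E - F" for e
    proof (rule ccontr)
      assume "\<not> ?thesis"
      moreover have "r G \<le> r (insert e G)" using that F by (intro rk_mono) auto
      ultimately have "r (insert e F) = r F"
        using that F by (simp add: rk_insert_mono[of G F e])
      then show False using that assms flat_memI by blast
    qed
    moreover have "ground (restriction M F) = F" "rk (restriction M F) = r"
      by (simp_all add: restriction_def)
    ultimately show ?thesis
      using F unfolding flat_iff R.flat_iff by (metis Diff_iff subset_eq)
  qed
  then have "flats_of_rank (restriction M F) 1 = {G \<in> flats_of_rank M 1. G \<subseteq> F}"
    by (auto simp: flats_of_rank_def restriction_def)
  then show ?thesis by (simp add: R.num_parallel_classes_eq)
qed

text \<open>Adding \<open>F\<close> back is a bijection from the rank 1 flats of the contraction,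
  which are its parallel classes, to the flats of \<open>M\<close> that contain \<open>F\<close> and
  have rank one more.\<close>

lemma num_parallel_classes_contraction:
  assumes "flat M F"
  shows "num_parallel_classes (contraction M F)
    = card {G \<in> flats_of_rank M (Suc (r F)). F \<subseteq> G}"
proof -
  have F: "F \<subseteq> E" using assms by (simp add: flat_def)
  let ?N = "contraction M F"
  have ground: "ground ?N = E - F" and rk: "rk ?N A = r (A \<union> F) - r F" for A
    by (simp_all add: contraction_def)
  \<comment> \<open>This bound makes the truncated subtraction in the rank of the contraction
    exact.\<close>
  have F_le: "r F \<le> r (A \<union> F)" if "A \<subseteq> E" for A
    using that F by (intro rk_mono) auto
  interpret N: loopless_matroid ?N
  proof
    have "r (A \<union> F) - r F \<le> card A" if "A \<subseteq> E - F" for A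
    proof -
      have "r (A \<union> F) \<le> r A + r F"
        using rk_submodular[of A F] that F by fastforce
      also have "r A \<le> card A" using that by (intro rk_le_card) auto
      finally show ?thesis by simp
    qed
    moreover have "r (A \<union> F) - r F \<le> r (B \<union> F) - r F" if "A \<subseteq> B" "B \<subseteq> E - F" for A B
      using that F by (intro diff_le_mono rk_mono) auto
    moreover have "(r (A \<union> B \<union> F) - r F) + (r (A \<inter> B \<union> F) - r F)
        \<le> (r (A \<union> F) - r F) + (r (B \<union> F) - r F)" if "A \<subseteq> E - F" "B \<subseteq> E - F" for A B
    proof -
      have "(A \<union> F) \<union> (B \<union> F) = A \<union> B \<union> F" "(A \<union> F) \<inter> (B \<union> F) = A \<inter> B \<union> F"
        by auto
      then have "r (A \<union> B \<union> F) + r (A \<inter> B \<union> F) \<le> r (A \<union> F) + r (B \<union> F)"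
        using rk_submodular[of "A \<union> F" "B \<union> F"] that F by auto
      moreover have "r F \<le> r (A \<inter> B \<union> F)" "r F \<le> r (A \<union> B \<union> F)"
        using that by (auto intro!: F_le)
      ultimately show ?thesis by simp
    qed
    ultimately show "matroid ?N"
      unfolding matroid_def ground rk using finite_ground by blast
    \<comment> \<open>A loop of the contraction would be an element outside \<open>F\<close> that
      does not raise the rank of \<open>F\<close>, which flatness rules out.\<close>
    show "loopless ?N"
      unfolding loopless_def ground rk using assms
      unfolding flat_iff by (simp add: not_le)
  qed
  have flat: "flat ?N G \<longleftrightarrow> flat M (G \<union> F)" if "G \<subseteq> E - F" for G
  proof -
    have "r F \<le> r (G \<union> F)" using that by (intro F_le) auto
    then have "r (G \<union> F) - r F < r (insert e G \<union> F) - r F \<longleftrightarrow> r (G \<union> F) < r (insert e (G \<union> F))" for e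
      by auto
    then show ?thesis
      unfolding flat_iff N.flat_iff ground rk using that F by auto
  qed
  have "bij_betw (\<lambda>G. G \<union> F) (flats_of_rank ?N 1) {G \<in> flats_of_rank M (Suc (r F)). F \<subseteq> G}"
  proof (rule bij_betw_byWitness[where f' = "\<lambda>G. G - F"])
    show "\<forall>G\<in>flats_of_rank ?N 1. G \<union> F - F = G"
      using N.flats_of_rank_subset ground by fastforce
    show "\<forall>G\<in>{G \<in> flats_of_rank M (Suc (r F)). F \<subseteq> G}. (G - F) \<union> F = G"
      by auto
    show "(\<lambda>G. G \<union> F) ` flats_of_rank ?N 1 \<subseteq> {G \<in> flats_of_rank M (Suc (r F)). F \<subseteq> G}"
    proof safe
      fix G assume G: "G \<in> flats_of_rank ?N 1"
      then have "G \<subseteq> E - F" using N.flats_of_rank_subset ground by auto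
      then show "G \<union> F \<in> flats_of_rank M (Suc (r F))"
        using G flat[of G] F_le[of G] by (auto simp: flats_of_rank_def rk)
    qed
    show "(\<lambda>G. G - F) ` {G \<in> flats_of_rank M (Suc (r F)). F \<subseteq> G} \<subseteq> flats_of_rank ?N 1"
    proof safe
      fix G assume G: "G \<in> flats_of_rank M (Suc (r F))" "F \<subseteq> G"
      then have "G - F \<subseteq> E - F" "G - F \<union> F = G" using flats_of_rank_subset[OF G(1)] by auto
      then show "G - F \<in> flats_of_rank ?N 1"
        using G flat[of "G - F"] by (auto simp: flats_of_rank_def rk)
    qed
  qed
  then show ?thesis
    using N.num_parallel_classes_eq bij_betw_same_card by metis
qed

section \<open>Cyclic flats of rank 1\<close>

lemma cyclic_flat_of_rank_1:
  assumes "F \<in> flats_of_rank M 1" "2 \<le> card F"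
  shows "F \<in> cyclic_flats_of_rank M 1"
proof -
  have F: "F \<subseteq> E" "r F = 1" using assms by (auto simp: flats_of_rank_def flat_def)
  have "\<exists>C. circuit M C \<and> C \<subseteq> F \<and> e \<in> C" if e: "e \<in> F" for e
  proof -
    have "F \<noteq> {e}" using assms by auto
    \<comment> \<open>Two distinct elements of a rank 1 flat form a circuit, so any second element
      serves as partner of \<open>e\<close>.\<close>
    then obtain f where f: "f \<in> F" "f \<noteq> e" using e by blast
    have "r {e, f} = 1"
      using rk_pair[of F] e f F by blast
    moreover have "{e, f} - {e} = {f}" "{e, f} - {f} = {e}" using f by auto
    ultimately have "circuit M {e, f}"
      using e f F rk_singleton by (auto simp: circuit_def)
    then show ?thesis using e f by blast
  qed
  then show ?thesis
    using assms by (auto simp: cyclic_flats_of_rank_def cyclic_flat_def flats_of_rank_def)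
qed

text \<open>A rank 1 flat that is not cyclic has fewer than two elements, so its inner sum is empty.
  Sums over cyclic flats can therefore be computed over all flats of rank 1.\<close>

lemma sum_cyclic_flats_of_rank_1:
  fixes c :: "'a set \<Rightarrow> int"
  assumes "2 \<le> k"
  shows "(\<Sum>F\<in>cyclic_flats_of_rank M 1. c F * (\<Sum>A\<in>{A. A \<subseteq> F \<and> k \<le> card A}. g A))
    = (\<Sum>F\<in>flats_of_rank M 1. c F * (\<Sum>A\<in>{A. A \<subseteq> F \<and> k \<le> card A}. g A))"
proof (rule sum.mono_neutral_left)
  show "cyclic_flats_of_rank M 1 \<subseteq> flats_of_rank M 1"
    by (auto simp: cyclic_flats_of_rank_def flats_of_rank_def cyclic_flat_def)
  show "\<forall>F\<in>flats_of_rank M 1 - cyclic_flats_of_rank M 1.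
      c F * (\<Sum>A\<in>{A. A \<subseteq> F \<and> k \<le> card A}. g A) = 0"
  proof
    fix F assume F: "F \<in> flats_of_rank M 1 - cyclic_flats_of_rank M 1"
    then have "card F < k" using cyclic_flat_of_rank_1[of F] assms by force
    moreover have "finite F" using F flats_of_rank_subset finite_subset_ground by blast
    ultimately have "{A. A \<subseteq> F \<and> k \<le> card A} = {}"
      using card_mono[of F] by (metis (no_types, lifting) Collect_empty_eq leD order.trans)
    then show "c F * (\<Sum>A\<in>{A. A \<subseteq> F \<and> k \<le> card A}. g A) = 0" by (simp only: sum.empty mult_zero_right)
  qed
qed (rule finite_flats_of_rank)

section \<open>Sums over flats and their subsets\<close>

lemma sum_flats_of_rank:
  fixes g :: "'a set \<Rightarrow> int"
  shows "(\<Sum>F\<in>flats_of_rank M i. \<Sum>A\<in>{A. A \<subseteq> F}. g A)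
    = (\<Sum>A\<in>Pow E. int (card {F \<in> flats_of_rank M i. A \<subseteq> F}) * g A)"
proof -
  have "(\<Sum>F\<in>flats_of_rank M i. \<Sum>A\<in>{A. A \<subseteq> F}. g A)
      = (\<Sum>F\<in>flats_of_rank M i. \<Sum>A\<in>{A \<in> Pow E. A \<subseteq> F}. g A)"
    using flats_of_rank_subset by (intro sum.cong) auto
  then show ?thesis
    using sum_restrict_count[where I = "flats_of_rank M i" and J = "Pow E"
        and R = "\<lambda>F A. A \<subseteq> F" and g = g]
    by (simp add: finite_flats_of_rank finite_ground)
qed

text \<open>Every set of rank \<open>i\<close> lies in exactly one flat of rank \<open>i\<close>,
  its closure.\<close>

lemma sum_by_closure:
  fixes g :: "'a set \<Rightarrow> int"
  shows "(\<Sum>A\<in>{A \<in> Pow E. r A = i}. g A)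
    = (\<Sum>F\<in>flats_of_rank M i. \<Sum>A\<in>{A. A \<subseteq> F \<and> r A = i}. g A)"
proof -
  have "(\<Sum>F\<in>flats_of_rank M i. \<Sum>A\<in>{A. A \<subseteq> F \<and> r A = i}. g A)
      = (\<Sum>F\<in>flats_of_rank M i. \<Sum>A\<in>{A \<in> {A \<in> Pow E. r A = i}. A \<subseteq> F}. g A)"
    using flats_of_rank_subset by (intro sum.cong) auto
  also have "\<dots> = (\<Sum>A\<in>{A \<in> Pow E. r A = i}. int (card {F \<in> flats_of_rank M i. A \<subseteq> F}) * g A)"
    by (rule sum_restrict_count) (simp_all add: finite_flats_of_rank finite_ground)
  also have "\<dots> = (\<Sum>A\<in>{A \<in> Pow E. r A = i}. g A)"
    by (intro sum.cong) (simp_all add: card_flats_above)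
  finally show ?thesis by simp
qed

text \<open>By looplessness the empty set is the only set of rank 0.\<close>

lemma sum_rank_le_2:
  fixes g :: "'a set \<Rightarrow> int"
  assumes "\<And>A. A \<subseteq> E \<Longrightarrow> 2 < r A \<Longrightarrow> g A = 0"
  shows "(\<Sum>A\<in>Pow E. g A) = g {} + (\<Sum>A\<in>{A \<in> Pow E. r A = 1}. g A)
    + (\<Sum>A\<in>{A \<in> Pow E. r A = 2}. g A)"
proof -
  have "(\<Sum>A\<in>Pow E. g A)
      = (\<Sum>A\<in>{{}} \<union> {A \<in> Pow E. r A = 1} \<union> {A \<in> Pow E. r A = 2}. g A)"
  proof (rule sum.mono_neutral_right)
    show "\<forall>A\<in>Pow E - ({{}} \<union> {A \<in> Pow E. r A = 1} \<union> {A \<in> Pow E. r A = 2}). g A = 0"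
    proof
      fix A assume "A \<in> Pow E - ({{}} \<union> {A \<in> Pow E. r A = 1} \<union> {A \<in> Pow E. r A = 2})"
      then have "A \<subseteq> E" "r A \<noteq> 0" "r A \<noteq> 1" "r A \<noteq> 2" by (auto simp: rk_eq_0_iff)
      then show "g A = 0" by (intro assms) auto
    qed
  qed (auto simp: finite_ground)
  also have "\<dots> = g {} + (\<Sum>A\<in>{A \<in> Pow E. r A = 1}. g A) + (\<Sum>A\<in>{A \<in> Pow E. r A = 2}. g A)"
    using finite_ground by (simp add: sum.union_disjoint disjoint_iff)
  finally show ?thesis .
qed

lemma no_flats_above:
  assumes "A \<subseteq> E" "i < r A"
  shows "{F \<in> flats_of_rank M i. A \<subseteq> F} = {}"
proof -
  have False if "F \<in> flats_of_rank M i" "A \<subseteq> F" for F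
    using rk_mono[of A F] that flats_of_rank_subset[of F] rk_flats_of_rank[of F] assms by auto
  then show ?thesis by blast
qed

text \<open>The empty set is counted by every rank 1 flat, a set of rank 1 by its closure only, and
  a set of larger rank by none.\<close>

lemma sum_flats_of_rank_1:
  fixes g :: "'a set \<Rightarrow> int"
  shows "(\<Sum>F\<in>flats_of_rank M 1. \<Sum>A\<in>{A. A \<subseteq> F}. g A)
    = int (num_parallel_classes M) * g {} + (\<Sum>A\<in>{A \<in> Pow E. r A = 1}. g A)"
proof -
  have "(\<Sum>A\<in>{A \<in> Pow E. r A = 1}. int (card {F \<in> flats_of_rank M 1. A \<subseteq> F}) * g A)
      = (\<Sum>A\<in>{A \<in> Pow E. r A = 1}. g A)"
    by (intro sum.cong) (simp_all add: card_flats_above)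
  moreover have "(\<Sum>A\<in>{A \<in> Pow E. r A = 2}. int (card {F \<in> flats_of_rank M 1. A \<subseteq> F}) * g A) = 0"
    by (intro sum.neutral) (simp add: no_flats_above)
  ultimately show ?thesis
    unfolding sum_flats_of_rank
    by (subst sum_rank_le_2) (simp_all add: no_flats_above num_parallel_classes_eq)
qed

text \<open>The empty set is counted by every rank 2 flat, a set of rank 1 with closure
  \<open>F\<close> by as many flats as the contraction of \<open>F\<close> has parallel classes, and
  a set of rank 2 once.\<close>

lemma sum_flats_of_rank_2:
  fixes g :: "'a set \<Rightarrow> int"
  shows "(\<Sum>F\<in>flats_of_rank M 2. \<Sum>A\<in>{A. A \<subseteq> F}. g A)
    = int (card (flats_of_rank M 2)) * g {}
      + (\<Sum>F\<in>flats_of_rank M 1. int (num_parallel_classes (contraction M F))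
          * ((\<Sum>A\<in>{A. A \<subseteq> F}. g A) - g {}))
      + (\<Sum>A\<in>{A \<in> Pow E. r A = 2}. g A)"
proof -
  let ?c = "\<lambda>A. int (card {F \<in> flats_of_rank M 2. A \<subseteq> F})"
  have rank_2: "(\<Sum>A\<in>{A \<in> Pow E. r A = 2}. ?c A * g A) = (\<Sum>A\<in>{A \<in> Pow E. r A = 2}. g A)"
    by (intro sum.cong) (simp_all add: card_flats_above)
  have "(\<Sum>A\<in>{A. A \<subseteq> F \<and> r A = 1}. ?c A * g A)
      = int (num_parallel_classes (contraction M F)) * ((\<Sum>A\<in>{A. A \<subseteq> F}. g A) - g {})"
    if F: "F \<in> flats_of_rank M 1" for F
  proof -
    have FE: "F \<subseteq> E" "flat M F" "r F = 1" using F by (auto simp: flats_of_rank_def flat_def)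
    have c: "?c A = int (num_parallel_classes (contraction M F))" if "A \<subseteq> F" "r A = 1" for A
      using flats_above_eq_flats_above_closure[of A F 2] num_parallel_classes_contraction[of F]
        that F FE by (simp add: numeral_2_eq_2)
    \<comment> \<open>The rank 1 subsets of \<open>F\<close> are its nonempty subsets, which
      explains the correction \<open>- g {}\<close>.\<close>
    have "{A. A \<subseteq> F \<and> r A = 1} = {A. A \<subseteq> F} - {{}}"
    proof (intro equalityI subsetI)
      fix A assume A: "A \<in> {A. A \<subseteq> F} - {{}}"
      then have "A \<subseteq> F" "A \<subseteq> E" "A \<noteq> {}" using FE by auto
      then have "r A \<le> 1" "r A \<noteq> 0"
        using rk_mono[of A F] rk_eq_0_iff[of A] FE by auto
      then show "A \<in> {A. A \<subseteq> F \<and> r A = 1}" using A by auto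
    qed auto
    moreover have "finite {A. A \<subseteq> F}"
      using FE finite_subset_ground by auto
    ultimately have "(\<Sum>A\<in>{A. A \<subseteq> F \<and> r A = 1}. g A) = (\<Sum>A\<in>{A. A \<subseteq> F}. g A) - g {}"
      by (simp add: sum_diff1)
    moreover have "(\<Sum>A\<in>{A. A \<subseteq> F \<and> r A = 1}. ?c A * g A)
      = int (num_parallel_classes (contraction M F)) * (\<Sum>A\<in>{A. A \<subseteq> F \<and> r A = 1}. g A)"
      unfolding sum_distrib_left using c by (intro sum.cong) auto
    ultimately show ?thesis by simp
  qed
  then have rank_1: "(\<Sum>A\<in>{A \<in> Pow E. r A = 1}. ?c A * g A)
      = (\<Sum>F\<in>flats_of_rank M 1. int (num_parallel_classes (contraction M F))
          * ((\<Sum>A\<in>{A. A \<subseteq> F}. g A) - g {}))"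
    unfolding sum_by_closure by (rule sum.cong[OF refl])
  show ?thesis
    unfolding sum_flats_of_rank[of _ 2]
    by (subst sum_rank_le_2) (simp_all only: rank_1 rank_2, simp_all add: no_flats_above)
qed

text \<open>Both sides count the pairs of a rank 1 flat inside a rank 2 flat.\<close>

lemma sum_contraction_eq_sum_restriction:
  "(\<Sum>F\<in>flats_of_rank M 1. int (num_parallel_classes (contraction M F)))
    = (\<Sum>F\<in>flats_of_rank M 2. int (num_parallel_classes (restriction M F)))"
proof -
  have "(\<Sum>F\<in>flats_of_rank M 1. int (num_parallel_classes (contraction M F)))
      = (\<Sum>F\<in>flats_of_rank M 1. \<Sum>G\<in>{G \<in> flats_of_rank M 2. F \<subseteq> G}. 1)"
    using num_parallel_classes_contraction
    by (intro sum.cong) (auto simp: flats_of_rank_def numeral_2_eq_2)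
  also have "\<dots> = (\<Sum>G\<in>flats_of_rank M 2. \<Sum>F\<in>{F \<in> flats_of_rank M 1. F \<subseteq> G}. 1)"
    by (rule sum.swap_restrict) (simp_all add: finite_flats_of_rank)
  also have "\<dots> = (\<Sum>G\<in>flats_of_rank M 2. int (num_parallel_classes (restriction M G)))"
    using num_parallel_classes_restriction
    by (intro sum.cong) (auto simp: flats_of_rank_def)
  finally show ?thesis .
qed

section \<open>Coefficients as signed sums over subsets\<close>

definition signed_term :: "('a set \<Rightarrow> int) \<Rightarrow> nat \<Rightarrow> 'a set \<Rightarrow> int" where
  "signed_term m j A = (-1) ^ (card A + j) * int ((card A - r A) choose j) * m A"

text \<open>The signs from the powers of \<open>x - 1\<close> and \<open>y - 1\<close> combine to
  \<open>(-1) ^ k\<close> times the sign in \<open>signed_term\<close>, because the rank enters both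
  exponents and cancels modulo 2. The guard \<open>r A \<le> k\<close> matters: beyond it
  \<open>k - r A\<close> truncates to 0 and the binomial coefficient would be 1.\<close>

lemma coeff_eq_sum:
  "tutte_coeff M m (int (total_rank M) - int k) (int j) =
    (-1) ^ k * (\<Sum>A\<in>Pow E. int (if r A \<le> k then (total_rank M - r A) choose (k - r A) else 0)
      * signed_term m j A)"
proof (cases "k \<le> total_rank M")
  case False
  \<comment> \<open>The left side is 0 by convention, its index being negative. On the right,
    \<open>k - r A\<close> exceeds \<open>total_rank M - r A\<close>, so each binomial coefficient
    vanishes.\<close>
  have "(if r A \<le> k then (total_rank M - r A) choose (k - r A) else 0) = 0" if "A \<in> Pow E" for A
    using that rk_mono[of A E] False by (auto simp: total_rank_def)
  then have zero: "(\<Sum>A\<in>Pow E. int (if r A \<le> k then (total_rank M - r A) choose (k - r A) else 0)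
      * signed_term m j A) = 0"
    by (intro sum.neutral ballI) (simp only: of_nat_0 mult_zero_left)
  show ?thesis unfolding zero using False by (simp add: tutte_coeff_def)
next
  case True
  let ?t = "total_rank M"
  have "coeff (coeff (of_int (m A) * (var_x - 1) ^ (?t - r A) * (var_y - 1) ^ (card A - r A)) (?t - k)) j
      = (-1) ^ k * (int (if r A \<le> k then (?t - r A) choose (k - r A) else 0)
        * signed_term m j A)" if "A \<subseteq> E" for A
  proof -
    have le: "r A \<le> ?t" "r A \<le> card A"
      using that rk_mono[of A E] rk_le_card[of A] by (auto simp: total_rank_def)
    show ?thesis
    proof (cases "r A \<le> k \<and> j \<le> card A - r A")
      case False
      then show ?thesis
        unfolding coeff_tutte_term signed_term_def using True le by (auto simp: binomial_eq_0)
    next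
      case rj: True
      have binomial: "(?t - r A) choose (?t - k) = (?t - r A) choose (k - r A)"
        using True rj le by (subst binomial_symmetric) auto
      \<comment> \<open>The even summand \<open>2 * (r A + j)\<close> absorbs the subtractions
        without changing the sign.\<close>
      have exponent: "?t - r A - (?t - k) + (card A - r A - j) + 2 * (r A + j) = k + (card A + j)"
        using rj le True by auto
      have sign: "(-1) ^ (?t - r A - (?t - k)) * (-1) ^ (card A - r A - j)
          = (-1 :: int) ^ k * (-1) ^ (card A + j)"
        unfolding power_add[symmetric] exponent[symmetric] by (simp add: power_add power_mult)
      have rearrange: "m A * (c * s) * (d * s') = s * s' * (c * (d * m A))" for c d s s' :: int
        by (simp only: mult_ac)
      show ?thesis
        unfolding coeff_tutte_term signed_term_def binomial rearrange sign
        using rj by (simp only: if_True mult_ac)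
    qed
  qed
  then have "coeff (coeff (multiplicity_tutte M m) (?t - k)) j
     = (-1) ^ k * (\<Sum>A\<in>Pow E. int (if r A \<le> k then (?t - r A) choose (k - r A) else 0)
        * signed_term m j A)"
    by (simp add: multiplicity_tutte_def coeff_sum sum_distrib_left)
  moreover have "nat (int ?t - int k) = ?t - k" by simp
  ultimately show ?thesis
    using True by (simp add: tutte_coeff_def)
qed

lemma coeff_codegree_0:
  "tutte_coeff M m (int (total_rank M)) (int j) = signed_term m j {}"
proof -
  have "(\<Sum>A\<in>Pow E. int (if r A \<le> 0 then (total_rank M - r A) choose (0 - r A) else 0)
      * signed_term m j A) = (\<Sum>A\<in>{{}}. signed_term m j A)"
    using finite_ground by (intro sum.mono_neutral_cong_right) (auto simp: rk_eq_0_iff)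
  then show ?thesis
    using coeff_eq_sum[of m 0 j] by simp
qed

text \<open>The empty set has weight \<open>total_rank M\<close> and each rank 1 set weight 1.
  Passing to the sum over rank 1 flats counts the empty set once per parallel class, which is
  corrected in the first summand.\<close>

lemma coeff_codegree_1:
  "tutte_coeff M m (int (total_rank M) - 1) (int j) =
    (int (num_parallel_classes M) - int (total_rank M)) * signed_term m j {}
    - (\<Sum>F\<in>flats_of_rank M 1. \<Sum>A\<in>{A. A \<subseteq> F}. signed_term m j A)"
proof -
  let ?c = "\<lambda>A. int (if r A \<le> 1 then (total_rank M - r A) choose (1 - r A) else 0)"
  have "(\<Sum>A\<in>Pow E. ?c A * signed_term m j A) = ?c {} * signed_term m j {}
      + (\<Sum>A\<in>{A \<in> Pow E. r A = 1}. ?c A * signed_term m j A)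
      + (\<Sum>A\<in>{A \<in> Pow E. r A = 2}. ?c A * signed_term m j A)"
    by (rule sum_rank_le_2) simp
  also have "(\<Sum>A\<in>{A \<in> Pow E. r A = 1}. ?c A * signed_term m j A)
      = (\<Sum>A\<in>{A \<in> Pow E. r A = 1}. signed_term m j A)"
    by (intro sum.cong) auto
  also have "(\<Sum>A\<in>{A \<in> Pow E. r A = 2}. ?c A * signed_term m j A) = 0"
    by (intro sum.neutral) auto
  finally show ?thesis
    using coeff_eq_sum[of m 1 j] unfolding sum_flats_of_rank_1
    by (simp add: algebra_simps)
qed

text \<open>Sets of rank 0, 1 and 2 have weights \<open>total_rank M choose 2\<close>,
  \<open>total_rank M - 1\<close> and 1. Replacing the sums over ranks 1 and 2 by sums over flats
  leaves corrections at the empty set, among them the total of the contraction counts, which becomes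
  a total of restriction counts.\<close>

lemma coeff_codegree_2:
  "tutte_coeff M m (int (total_rank M) - 2) (int j) =
    (int (total_rank M choose 2) - (int (total_rank M) - 1) * int (num_parallel_classes M)
      + (\<Sum>F \<in> flats_of_rank M 2. int (num_parallel_classes (restriction M F)) - 1))
      * signed_term m j {}
    - (\<Sum>F\<in>flats_of_rank M 1.
        (int (num_parallel_classes (contraction M F)) - int (total_rank M) + 1)
        * (\<Sum>A\<in>{A. A \<subseteq> F}. signed_term m j A))
    + (\<Sum>F\<in>flats_of_rank M 2. \<Sum>A\<in>{A. A \<subseteq> F}. signed_term m j A)"
proof -
  let ?s = "signed_term m j" and ?t = "total_rank M"
  let ?c = "\<lambda>A. int (if r A \<le> 2 then (?t - r A) choose (2 - r A) else 0)"
  let ?T = "\<lambda>F. \<Sum>A\<in>{A. A \<subseteq> F}. ?s A"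
  let ?q = "\<lambda>F. int (num_parallel_classes (contraction M F))"
  have "(\<Sum>A\<in>Pow E. ?c A * ?s A) = ?c {} * ?s {}
      + (\<Sum>A\<in>{A \<in> Pow E. r A = 1}. ?c A * ?s A)
      + (\<Sum>A\<in>{A \<in> Pow E. r A = 2}. ?c A * ?s A)"
    by (rule sum_rank_le_2) simp
  also have "(\<Sum>A\<in>{A \<in> Pow E. r A = 1}. ?c A * ?s A)
      = (int ?t - 1) * (\<Sum>A\<in>{A \<in> Pow E. r A = 1}. ?s A)"
    unfolding sum_distrib_left
  proof (intro sum.cong refl)
    fix A assume "A \<in> {A \<in> Pow E. r A = 1}"
    \<comment> \<open>The existence of a rank 1 set makes the natural-number difference
      \<open>?t - 1\<close> exact.\<close>
    moreover from this have "1 \<le> ?t" using rk_mono[of A E] by (simp add: total_rank_def)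
    ultimately show "?c A * ?s A = (int ?t - 1) * ?s A" by (simp add: of_nat_diff)
  qed
  also have "(\<Sum>A\<in>{A \<in> Pow E. r A = 2}. ?c A * ?s A) = (\<Sum>A\<in>{A \<in> Pow E. r A = 2}. ?s A)"
    by (intro sum.cong) auto
  finally have coeff: "tutte_coeff M m (int ?t - 2) (int j) = int (?t choose 2) * ?s {}
      + (int ?t - 1) * (\<Sum>A\<in>{A \<in> Pow E. r A = 1}. ?s A) + (\<Sum>A\<in>{A \<in> Pow E. r A = 2}. ?s A)"
    using coeff_eq_sum[of m 2 j] by simp
  have q_sum: "(\<Sum>F\<in>flats_of_rank M 1. ?q F * (?T F - ?s {}))
      = (\<Sum>F\<in>flats_of_rank M 1. ?q F * ?T F) - (\<Sum>F\<in>flats_of_rank M 1. ?q F) * ?s {}"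
    by (simp add: right_diff_distrib sum_subtractf sum_distrib_right)
  have linear: "(\<Sum>F\<in>flats_of_rank M 1. (?q F - int ?t + 1) * ?T F)
      = (\<Sum>F\<in>flats_of_rank M 1. ?q F * ?T F) - (int ?t - 1) * (\<Sum>F\<in>flats_of_rank M 1. ?T F)"
    by (simp add: algebra_simps sum_subtractf sum.distrib sum_distrib_left)
  have restr: "(\<Sum>F\<in>flats_of_rank M 2. int (num_parallel_classes (restriction M F)) - 1)
      = (\<Sum>F\<in>flats_of_rank M 1. ?q F) - int (card (flats_of_rank M 2))"
    unfolding sum_contraction_eq_sum_restriction by (simp add: sum_subtractf)
  show ?thesis
    unfolding coeff linear restr sum_flats_of_rank_2[of ?s] q_sum sum_flats_of_rank_1[of ?s]
    by (simp add: algebra_simps)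
qed

section \<open>Terms that vanish for positive powers of \<open>y\<close>\<close>

lemma signed_term_empty: "signed_term m j {} = (if j = 0 then m {} else 0)"
  by (cases j) (auto simp: signed_term_def)

text \<open>A nonempty set has positive rank, so its nullity \<open>card A - r A\<close> is below
  \<open>j\<close>; the empty set has nullity 0, also below \<open>j\<close>.\<close>

lemma signed_term_eq_0:
  assumes "A \<subseteq> E" "card A \<le> j" "0 < j"
  shows "signed_term m j A = 0"
proof (cases "A = {}")
  case False
  then have "r A \<noteq> 0" using assms rk_eq_0_iff by blast
  then show ?thesis using assms by (simp add: signed_term_def binomial_eq_0)
qed (use assms in \<open>simp add: signed_term_empty\<close>)

lemma sum_signed_term:
  assumes "F \<subseteq> E" "0 < j"
  shows "(\<Sum>A\<in>{A. A \<subseteq> F}. signed_term m j A)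
    = (\<Sum>A\<in>{A. A \<subseteq> F \<and> Suc j \<le> card A}. signed_term m j A)"
proof (rule sum.mono_neutral_right)
  show "\<forall>A\<in>{A. A \<subseteq> F} - {A. A \<subseteq> F \<and> Suc j \<le> card A}. signed_term m j A = 0"
    using assms by (auto simp: not_less_eq_eq intro!: signed_term_eq_0)
qed (use assms finite_subset_ground in auto)

text \<open>The remaining subsets of \<open>F\<close> are nonempty and hence have rank 1, so the
  nullity is \<open>card A - 1\<close>.\<close>

lemma sum_signed_term_rank_1:
  assumes "F \<in> flats_of_rank M 1" "0 < j"
  shows "(\<Sum>A\<in>{A. A \<subseteq> F}. signed_term m j A)
    = (\<Sum>A\<in>{A. A \<subseteq> F \<and> Suc j \<le> card A}. (-1) ^ (card A + j) * int ((card A - 1) choose j) * m A)"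
proof -
  have F: "F \<subseteq> E" "r F = 1" using assms by (auto simp: flats_of_rank_def flat_def)
  have "r A = 1" if "A \<subseteq> F" "Suc j \<le> card A" for A
    using rk_mono[of A F] rk_eq_0_iff[of A] that F by fastforce
  then show ?thesis
    unfolding sum_signed_term[OF F(1) assms(2)] unfolding signed_term_def
    by (intro sum.cong) auto
qed

end

theorem theorem3p3:
  fixes M :: "'a ranked_set" and m :: "'a set \<Rightarrow> int"
  assumes "multiplicity_matroid M m" and "loopless M"
  shows
    "tutte_coeff M m (int (total_rank M)) 0 = m {} \<and>
     tutte_coeff M m (int (total_rank M) - 1) 0 =
       (int (num_parallel_classes M) - int (total_rank M)) * m {}
       + (\<Sum>F \<in> flats_of_rank M 1. \<Sum>A \<in> {A. A \<subseteq> F}. (-1) ^ (card A + 1) * m A) \<and>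
     tutte_coeff M m (int (total_rank M) - 2) 0 =
       (int (total_rank M choose 2) - (int (total_rank M) - 1) * int (num_parallel_classes M)
          + (\<Sum>F \<in> flats_of_rank M 2. int (num_parallel_classes (restriction M F)) - 1)) * m {}
       + (\<Sum>F \<in> flats_of_rank M 1.
            (int (num_parallel_classes (contraction M F)) - int (total_rank M) + 1)
            * (\<Sum>A \<in> {A. A \<subseteq> F}. (-1) ^ (card A + 1) * m A))
       + (\<Sum>F \<in> flats_of_rank M 2. \<Sum>A \<in> {A. A \<subseteq> F}. (-1) ^ card A * m A) \<and>
     tutte_coeff M m (int (total_rank M) - 1) 1 =
       (\<Sum>F \<in> cyclic_flats_of_rank M 1.
          \<Sum>A \<in> {A. A \<subseteq> F \<and> card A \<ge> 2}. (-1) ^ card A * (int (card A) - 1) * m A) \<and>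
     tutte_coeff M m (int (total_rank M) - 2) 1 =
       (\<Sum>F \<in> cyclic_flats_of_rank M 1.
          (int (num_parallel_classes (contraction M F)) - int (total_rank M) + 1)
          * (\<Sum>A \<in> {A. A \<subseteq> F \<and> card A \<ge> 2}. (-1) ^ card A * (int (card A) - 1) * m A))
       + (\<Sum>F \<in> flats_of_rank M 2.
            \<Sum>A \<in> {A. A \<subseteq> F \<and> card A \<ge> 2}.
              (-1) ^ (card A + 1) * (int (card A) - int (rk M A)) * m A) \<and>
     tutte_coeff M m (int (total_rank M) - 2) 2 =
       (\<Sum>F \<in> cyclic_flats_of_rank M 1.
          (int (num_parallel_classes (contraction M F)) - int (total_rank M) + 1)
          * (\<Sum>A \<in> {A. A \<subseteq> F \<and> card A \<ge> 3}.
               (-1) ^ (card A + 1) * int ((card A - 1) choose 2) * m A))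
       + (\<Sum>F \<in> flats_of_rank M 2.
            \<Sum>A \<in> {A. A \<subseteq> F \<and> card A \<ge> 3}.
              (-1) ^ card A * int ((card A - rk M A) choose 2) * m A)"
proof -
  interpret loopless_matroid M
    using assms by unfold_locales (simp_all add: multiplicity_matroid_def)
  let ?q = "\<lambda>F. int (num_parallel_classes (contraction M F)) - int (total_rank M) + 1"
  have F1_1: "(\<Sum>A\<in>{A. A \<subseteq> F}. signed_term m 1 A)
      = - (\<Sum>A\<in>{A. A \<subseteq> F \<and> card A \<ge> 2}. (-1) ^ card A * (int (card A) - 1) * m A)"
    if "F \<in> flats_of_rank M 1" for F
    unfolding sum_signed_term_rank_1[OF that zero_less_one] sum_negf[symmetric]
    by (intro sum.cong) (auto simp: of_nat_diff)
  have F1_2: "(\<Sum>A\<in>{A. A \<subseteq> F}. signed_term m 2 A)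
      = - (\<Sum>A\<in>{A. A \<subseteq> F \<and> card A \<ge> 3}. (-1) ^ (card A + 1) * int ((card A - 1) choose 2) * m A)"
    if "F \<in> flats_of_rank M 1" for F
    unfolding sum_signed_term_rank_1[OF that zero_less_numeral] sum_negf[symmetric]
    by (intro sum.cong) auto
  \<comment> \<open>Large subsets of a rank 2 flat may still have rank 1, so the rank stays in the
    formula here.\<close>
  have F2_1: "(\<Sum>A\<in>{A. A \<subseteq> F}. signed_term m 1 A)
      = (\<Sum>A\<in>{A. A \<subseteq> F \<and> card A \<ge> 2}.
          (-1) ^ (card A + 1) * (int (card A) - int (rk M A)) * m A)"
    if "F \<in> flats_of_rank M 2" for F
  proof -
    have "F \<subseteq> ground M" using that by (rule flats_of_rank_subset)
    then show ?thesis
      unfolding sum_signed_term[OF \<open>F \<subseteq> ground M\<close> zero_less_one] unfolding signed_term_def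
      using rk_le_card by (intro sum.cong) (auto simp: of_nat_diff)
  qed
  have F2_2: "(\<Sum>A\<in>{A. A \<subseteq> F}. signed_term m 2 A)
      = (\<Sum>A\<in>{A. A \<subseteq> F \<and> card A \<ge> 3}. (-1) ^ card A * int ((card A - rk M A) choose 2) * m A)"
    if "F \<in> flats_of_rank M 2" for F
    unfolding sum_signed_term[OF flats_of_rank_subset[OF that] zero_less_numeral] unfolding signed_term_def
    by (intro sum.cong) auto
  \<comment> \<open>The minus sign cancels the one before the rank 1 sums in
    \<open>coeff_codegree_1\<close> and \<open>coeff_codegree_2\<close>. The weight \<open>c\<close>
    is 1 for the former and \<open>?q\<close> for the latter.\<close>
  have cyclic: "(\<Sum>F\<in>flats_of_rank M 1. c F * (\<Sum>A\<in>{A. A \<subseteq> F}. h A))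
      = - (\<Sum>F\<in>cyclic_flats_of_rank M 1. c F * (\<Sum>A\<in>{A. A \<subseteq> F \<and> card A \<ge> k}. g A))"
    if "2 \<le> k" and "\<And>F. F \<in> flats_of_rank M 1 \<Longrightarrow>
      (\<Sum>A\<in>{A. A \<subseteq> F}. h A) = - (\<Sum>A\<in>{A. A \<subseteq> F \<and> card A \<ge> k}. g A)"
    for c g h :: "'a set \<Rightarrow> int" and k
    unfolding sum_cyclic_flats_of_rank_1[OF that(1)] sum_negf[symmetric]
    using that(2) by (intro sum.cong) simp_all
  have 1: "tutte_coeff M m (int (total_rank M)) 0 = m {}"
    using coeff_codegree_0[of m 0] by (simp add: signed_term_empty)
  have 2: "tutte_coeff M m (int (total_rank M) - 1) 0 =
      (int (num_parallel_classes M) - int (total_rank M)) * m {}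
      + (\<Sum>F \<in> flats_of_rank M 1. \<Sum>A \<in> {A. A \<subseteq> F}. (-1) ^ (card A + 1) * m A)"
    using coeff_codegree_1[of m 0] by (simp add: signed_term_empty) (simp add: signed_term_def sum_negf)
  have 3: "tutte_coeff M m (int (total_rank M) - 2) 0 =
       (int (total_rank M choose 2) - (int (total_rank M) - 1) * int (num_parallel_classes M)
          + (\<Sum>F \<in> flats_of_rank M 2. int (num_parallel_classes (restriction M F)) - 1)) * m {}
       + (\<Sum>F \<in> flats_of_rank M 1.
            (int (num_parallel_classes (contraction M F)) - int (total_rank M) + 1)
            * (\<Sum>A \<in> {A. A \<subseteq> F}. (-1) ^ (card A + 1) * m A))
       + (\<Sum>F \<in> flats_of_rank M 2. \<Sum>A \<in> {A. A \<subseteq> F}. (-1) ^ card A * m A)"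
    using coeff_codegree_2[of m 0] by (simp add: signed_term_empty) (simp add: signed_term_def sum_negf)
  \<comment> \<open>From here on \<open>j\<close> is positive, so the term of the empty set drops
    out together with its factor.\<close>
  have 4: "tutte_coeff M m (int (total_rank M) - 1) 1 =
       (\<Sum>F \<in> cyclic_flats_of_rank M 1.
          \<Sum>A \<in> {A. A \<subseteq> F \<and> card A \<ge> 2}. (-1) ^ card A * (int (card A) - 1) * m A)"
    using coeff_codegree_1[of m 1]
      cyclic[where c = "\<lambda>_. 1", OF order.refl F1_1]
    by (simp add: signed_term_empty)
  have 5: "tutte_coeff M m (int (total_rank M) - 2) 1 =
       (\<Sum>F \<in> cyclic_flats_of_rank M 1.
          (int (num_parallel_classes (contraction M F)) - int (total_rank M) + 1)
          * (\<Sum>A \<in> {A. A \<subseteq> F \<and> card A \<ge> 2}. (-1) ^ card A * (int (card A) - 1) * m A))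
       + (\<Sum>F \<in> flats_of_rank M 2.
            \<Sum>A \<in> {A. A \<subseteq> F \<and> card A \<ge> 2}.
              (-1) ^ (card A + 1) * (int (card A) - int (rk M A)) * m A)"
    using coeff_codegree_2[of m 1] sum.cong[OF refl F2_1]
      cyclic[where c = ?q, OF order.refl F1_1]
    by (simp only: signed_term_empty) simp
  have 6: "tutte_coeff M m (int (total_rank M) - 2) 2 =
       (\<Sum>F \<in> cyclic_flats_of_rank M 1.
          (int (num_parallel_classes (contraction M F)) - int (total_rank M) + 1)
          * (\<Sum>A \<in> {A. A \<subseteq> F \<and> card A \<ge> 3}.
               (-1) ^ (card A + 1) * int ((card A - 1) choose 2) * m A))
       + (\<Sum>F \<in> flats_of_rank M 2.
            \<Sum>A \<in> {A. A \<subseteq> F \<and> card A \<ge> 3}.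
              (-1) ^ card A * int ((card A - rk M A) choose 2) * m A)"
    using coeff_codegree_2[of m 2] sum.cong[OF refl F2_2]
      cyclic[where c = ?q, OF _ F1_2]
    by (simp only: signed_term_empty) simp
  show ?thesis using 1 2 3 4 5 6 by blast
qed

end
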